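(* Let $d,n\ge 1$ be integers and let $\mathcal M=\{M_0,\dots,M_{n-1}\}$ be a $d$-dimensional POVM with $n$ effects. Let $t(\mathcal M)$ be its critical visibility and, for each integer $m\ge 2$, let $H_m(\mathcal M)$ be the optimal value of the $m$-th level of the SDP hierarchy defined in the context. Then $$H_2(\mathcal M)\ \ge\ H_3(\mathcal M)\ \ge\ \cdots\ \ge\ t(\mathcal M),$$ that is, $H_m(\mathcal M)\ge H_{m+1}(\mathcal M)$ and $H_m(\mathcal M)\ge t(\mathcal M)$ for all $m\ge 2$.
   Context: A $d$-dimensional POVM with $n$ effects is a tuple $\mathcal M=\{M_0,\dots,M_{n-1}\}$ of positive semidefinite complex $d\times d$ matrices with $\sum_{i=0}^{n-1} M_i=\mathbb I_d$. It is projective if $M_iM_j=\delta_{ij}M_i$ for all $i,j$ (zero effects are allowed). The set $\mathcal P(d,n)$ of (projectively) simulable POVMs is the convex hull of the set of projective $d$-dimensional POVMs with $n$ effects, i.e. $\mathcal M\in\mathcal P(d,n)$ iff $M_i=\sum_{k=1}^N p_kP_i^k$ for all $i$, for some $N$, some probability distribution $(p_k)$ and some projective POVMs $\{P_0^k,\dots,P_{n-1}^k\}$. For $0\le t\le 1$ put $\Phi_t(M_i)=tM_i+(1-t)\frac{\mathrm{Tr}(M_i)}{d}\mathbb I_d$ and $\Phi_t(\mathcal M)=\{\Phi_t(M_i)\}_i$. The critical visibility is $t(\mathcal M)=\max\{t\le 1:\Phi_t(\mathcal M)\in\mathcal P(d,n)\}$. For $m\ge2$ and $1\le a<b\le m$,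 let $V_{(ab)}$ be the unitary on $(\mathbb C^d)^{\otimes m}$ swapping tensor factors $a$ and $b$, and let $\mathrm{Tr}_a$ be the partial trace over factor $a$. $H_m(\mathcal M)$ is the maximum of $t\in[0,1]$ such that there exist $d^m\times d^m$ complex matrices $R_{i_1\dots i_m}$ acting on $(\mathbb C^d)^{\otimes m}$, indexed by $(i_1,\dots,i_m)\in\{0,\dots,n-1\}^m$, with: (1) $R_{i_1\dots i_m}\ge 0$ (positive semidefinite) for all indices; (2) for every $j\in\{1,\dots,m\}$ and every $i_j\in\{0,\dots,n-1\}$, the sum of $R_{i_1\dots i_m}$ over all indices other than $i_j$ equals $\mathbb I\otimes\cdots\otimes\Phi_t(M_{i_j})\otimes\cdots\otimes\mathbb I$, with $\Phi_t(M_{i_j})$ in the $j$-th tensor factor; (3) $\mathrm{Tr}_a(V_{(ab)}R_{i_1\dots i_m})=0$ for all $a<b$ and all $(i_1,\dots,i_m)$ with $i_a\ne i_b$. *)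

theory Defs
  imports "HOL-Analysis.Analysis"
begin

text \<open>
  The dimension \<open>d\<close> and the number of effects \<open>n\<close> are the cardinalities of the index types
  \<open>'d\<close> and \<open>'n\<close>; the number \<open>m\<close> of tensor factors is an ordinary natural number. Tensor
  factors are labelled by a finite set \<open>S\<close> of naturals (usually \<open>{1..m}\<close>), the standard basis of
  the tensor product over \<open>S\<close> is \<open>tuples S\<close>, and an operator on that space is its matrix in this
  basis. Only the entries with both indices in \<open>tuples S\<close> are meaningful.
\<close>

definition tuples :: "nat set \<Rightarrow> (nat \<Rightarrow> 'a) set" where
  "tuples S = (S \<rightarrow>\<^sub>E UNIV)"

type_synonym 'd tmat = "(nat \<Rightarrow> 'd) \<Rightarrow> (nat \<Rightarrow> 'd) \<Rightarrow> complex"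

lemma card_tuples:
  assumes "finite S"
  shows "card (tuples S :: (nat \<Rightarrow> 'a) set) = CARD('a) ^ card S"
  using assms by (simp add: tuples_def card_PiE)

text \<open>Over the complex numbers the condition below already forces \<open>A\<close> to be Hermitian on \<open>I\<close>.\<close>

definition psd_on :: "'i set \<Rightarrow> ('i \<Rightarrow> 'i \<Rightarrow> complex) \<Rightarrow> bool" where
  "psd_on I A \<longleftrightarrow> (\<forall>v. (\<Sum>x\<in>I. \<Sum>y\<in>I. cnj (v x) * A x y * v y) \<in> \<real>\<^sub>\<ge>\<^sub>0)"

definition psd :: "complex^'d^'d \<Rightarrow> bool" where
  "psd A \<longleftrightarrow> psd_on UNIV (\<lambda>i j. A $ i $ j)"

definition povm :: "complex^'d^'d^'n \<Rightarrow> bool" where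
  "povm M \<longleftrightarrow> (\<forall>i. psd (M $ i)) \<and> (\<Sum>i\<in>UNIV. M $ i) = mat 1"

definition projective_povm :: "complex^'d^'d^'n \<Rightarrow> bool" where
  "projective_povm M \<longleftrightarrow>
     povm M \<and> (\<forall>i j. M $ i ** M $ j = (if i = j then M $ i else 0))"

definition simulable :: "(complex^'d^'d^'n) set" where
  "simulable = convex hull {P. projective_povm P}"

definition depolarize :: "real \<Rightarrow> complex^'d^'d \<Rightarrow> complex^'d^'d" where
  "depolarize t X = t *\<^sub>R X + (1 - t) *\<^sub>R mat (trace X / of_nat CARD('d))"

definition depolarize_povm :: "real \<Rightarrow> complex^'d^'d^'n \<Rightarrow> complex^'d^'d^'n" where
  "depolarize_povm t M = (\<chi> i. depolarize t (M $ i))"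

text \<open>
  Both optimal values are genuine maxima, not suprema: \<open>Greatest\<close> is unspecified unless the
  maximum is attained.
\<close>

definition critical_visibility :: "complex^'d^'d^'n \<Rightarrow> real" where
  "critical_visibility M =
     (GREATEST t. 0 \<le> t \<and> t \<le> 1 \<and> depolarize_povm t M \<in> simulable)"

definition tmat_mult :: "nat set \<Rightarrow> 'd tmat \<Rightarrow> 'd tmat \<Rightarrow> 'd tmat" where
  "tmat_mult S A B = (\<lambda>x y. \<Sum>z\<in>tuples S. A x z * B z y)"

definition tensor :: "nat set \<Rightarrow> (nat \<Rightarrow> complex^'d^'d) \<Rightarrow> 'd tmat" where
  "tensor S X = (\<lambda>x y. \<Prod>a\<in>S. X a $ x a $ y a)"

definition swap_mat :: "nat \<Rightarrow> nat \<Rightarrow> 'd tmat" where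
  "swap_mat a b = (\<lambda>x y. if x = y(a := y b, b := y a) then 1 else 0)"

text \<open>The partial trace over factor \<open>a\<close> maps operators on the factors \<open>S\<close> to operators on
  the factors \<open>S - {a}\<close>.\<close>

definition partial_trace :: "nat \<Rightarrow> 'd::finite tmat \<Rightarrow> 'd tmat" where
  "partial_trace a A = (\<lambda>x y. \<Sum>k\<in>UNIV. A (x(a := k)) (y(a := k)))"

definition feasible ::
    "nat \<Rightarrow> complex^'d^'d^'n \<Rightarrow> real \<Rightarrow> ((nat \<Rightarrow> 'n) \<Rightarrow> 'd tmat) \<Rightarrow> bool" where
  "feasible m M t R \<longleftrightarrow>
     (\<forall>i \<in> tuples {1..m}. psd_on (tuples {1..m}) (R i)) \<and>
     (\<forall>j \<in> {1..m}. \<forall>k. \<forall>x \<in> tuples {1..m}. \<forall>y \<in> tuples {1..m}.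
        (\<Sum>i | i \<in> tuples {1..m} \<and> i j = k. R i x y) =
        tensor {1..m} (\<lambda>a. if a = j then depolarize t (M $ k) else mat 1) x y) \<and>
     (\<forall>a \<in> {1..m}. \<forall>b \<in> {1..m}. \<forall>i \<in> tuples {1..m}. a < b \<longrightarrow> i a \<noteq> i b \<longrightarrow>
        (\<forall>x \<in> tuples ({1..m} - {a}). \<forall>y \<in> tuples ({1..m} - {a}).
           partial_trace a (tmat_mult {1..m} (swap_mat a b) (R i)) x y = 0))"

definition hierarchy_value :: "nat \<Rightarrow> complex^'d^'d^'n \<Rightarrow> real" where
  "hierarchy_value m M = (GREATEST t. 0 \<le> t \<and> t \<le> 1 \<and> (\<exists>R. feasible m M t R))"

end

(*
  A projective POVM P satisfies the constraints of every level with the product operators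
  P i_1 (x) ... (x) P i_m: the partial trace of the swapped product contains the factor
  P i_a P i_b = 0. The constraints are jointly convex in the target POVM and in R, so every
  simulable POVM satisfies them too, whence H_m >= t. Summing a solution of level m + 1 over the
  last outcome and compressing the last factor to a basis vector gives a solution of level m,
  whence H_m >= H_(m+1). That all these maxima are attained is a compactness argument: the entries
  of R are bounded because the R_i are positive and have prescribed sums.
*)

theory Submission
  imports Defs
begin

section \<open>Positive semidefinite matrices\<close>

lemma psd_on_add: "psd_on I A \<Longrightarrow> psd_on I B \<Longrightarrow> psd_on I (\<lambda>x y. A x y + B x y)"
  unfolding psd_on_def
  by (simp add: ring_distribs sum.distrib nonneg_Reals_add_I)

lemma psd_on_scaleR:
  assumes "0 \<le> u" "psd_on I A"
  shows "psd_on I (\<lambda>x y. u *\<^sub>R A x y)"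
proof -
  have "(\<Sum>x\<in>I. \<Sum>y\<in>I. cnj (v x) * (u *\<^sub>R A x y) * v y)
      = of_real u * (\<Sum>x\<in>I. \<Sum>y\<in>I. cnj (v x) * A x y * v y)" for v
    by (simp add: scaleR_conv_of_real sum_distrib_left mult_ac)
  then show ?thesis
    using assms unfolding psd_on_def by (simp add: nonneg_Reals_mult_I)
qed

lemma psd_on_sum:
  assumes "\<And>l. l \<in> L \<Longrightarrow> psd_on I (A l)"
  shows "psd_on I (\<lambda>x y. \<Sum>l\<in>L. A l x y)"
  using assms
proof (induction L rule: infinite_finite_induct)
  case (insert l L)
  then show ?case
    using psd_on_add[of I "A l" "\<lambda>x y. \<Sum>l\<in>L. A l x y"] by simp
qed (simp_all add: psd_on_def)

text \<open>The quadratic form is the sum over \<open>z\<close> of the squared moduli of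
  \<open>\<Sum>x\<in>I. B z x * v x\<close>. Projections are of this form, being hermitian and
  idempotent.\<close>

lemma psd_on_gram: "psd_on I (\<lambda>x y. \<Sum>z\<in>Z. cnj (B z x) * B z y)"
proof (rule psd_on_sum)
  fix z
  show "psd_on I (\<lambda>x y. cnj (B z x) * B z y)"
    unfolding psd_on_def
  proof
    fix v
    have "(\<Sum>x\<in>I. \<Sum>y\<in>I. cnj (v x) * (cnj (B z x) * B z y) * v y)
        = cnj (\<Sum>x\<in>I. B z x * v x) * (\<Sum>y\<in>I. B z y * v y)"
      unfolding cnj_sum sum_product by (simp add: mult_ac)
    also have "\<dots> = of_real ((cmod (\<Sum>x\<in>I. B z x * v x))\<^sup>2)"
      by (metis complex_norm_square mult.commute of_real_power)
    also have "\<dots> \<in> \<real>\<^sub>\<ge>\<^sub>0"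
      by (simp only: nonneg_Reals_of_real_iff zero_le_power2)
    finally show "(\<Sum>x\<in>I. \<Sum>y\<in>I. cnj (v x) * (cnj (B z x) * B z y) * v y) \<in> \<real>\<^sub>\<ge>\<^sub>0" .
  qed
qed

text \<open>A test vector on \<open>J\<close> is transported along \<open>f\<close> and extended by
  zero. This covers diagonal entries, two-by-two principal submatrices and the compression of a
  tensor factor.\<close>

lemma psd_on_reindex:
  assumes "finite I" "psd_on I A" "inj_on f J" "f ` J \<subseteq> I"
  shows "psd_on J (\<lambda>x y. A (f x) (f y))"
  unfolding psd_on_def
proof
  fix v :: "'b \<Rightarrow> complex"
  define w where "w = (\<lambda>z. if z \<in> f ` J then v (inv_into J f z) else 0)"
  have w: "w (f x) = v x" if "x \<in> J" for x
    using that assms(3) by (simp add: w_def)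
  have "(\<Sum>x\<in>I. \<Sum>y\<in>I. cnj (w x) * A x y * w y)
      = (\<Sum>x\<in>f ` J. \<Sum>y\<in>I. cnj (w x) * A x y * w y)"
    using assms(1,4) by (intro sum.mono_neutral_right) (auto simp: w_def)
  also have "\<dots> = (\<Sum>x\<in>f ` J. \<Sum>y\<in>f ` J. cnj (w x) * A x y * w y)"
    using assms(1,4) by (intro sum.cong refl sum.mono_neutral_right) (auto simp: w_def)
  also have "\<dots> = (\<Sum>x\<in>J. \<Sum>y\<in>J. cnj (v x) * A (f x) (f y) * v y)"
    using assms(3) by (simp add: sum.reindex w cong: sum.cong)
  finally show "(\<Sum>x\<in>J. \<Sum>y\<in>J. cnj (v x) * A (f x) (f y) * v y) \<in> \<real>\<^sub>\<ge>\<^sub>0"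
    using assms(2) unfolding psd_on_def by metis
qed

lemma psd_on_diag:
  assumes "finite I" "psd_on I A" "x \<in> I"
  shows "A x x \<in> \<real>\<^sub>\<ge>\<^sub>0"
proof -
  have "psd_on (UNIV :: unit set) (\<lambda>_ _. A x x)"
    using assms(3) by (intro psd_on_reindex[OF assms(1,2), where f = "\<lambda>_. x"]) (auto simp: inj_on_def)
  then show ?thesis
    unfolding psd_on_def by (auto dest: spec[of _ "\<lambda>_. 1"])
qed

text \<open>This is the quadratic form at the vector with entry 1 at \<open>x\<close> and
  \<open>c\<close> at \<open>y\<close>. Varying the phase of \<open>c\<close> isolates the real and
  imaginary parts of the off-diagonal entries.\<close>

lemma psd_on_two_point:
  assumes "finite I" "psd_on I A" "x \<in> I" "y \<in> I" "x \<noteq> y"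
  shows "A x x + c * A x y + cnj c * A y x + cnj c * c * A y y \<in> \<real>\<^sub>\<ge>\<^sub>0"
proof -
  have "psd_on (UNIV :: bool set)
      (\<lambda>p q. A (if p then x else y) (if q then x else y))"
    using assms(3-5)
    by (intro psd_on_reindex[OF assms(1,2), where f = "\<lambda>p. if p then x else y"])
      (auto simp: inj_on_def split: if_splits)
  then have "(\<Sum>p\<in>UNIV. \<Sum>q\<in>UNIV. cnj (if p then 1 else c) *
      A (if p then x else y) (if q then x else y) * (if q then 1 else c)) \<in> \<real>\<^sub>\<ge>\<^sub>0"
    unfolding psd_on_def by (rule spec)
  then show ?thesis
    by (simp add: UNIV_bool algebra_simps)
qed

text \<open>With a real diagonal, \<open>c = 1\<close> makes \<open>A x y + A y x\<close> real, and
  \<open>c = \<i>\<close> makes \<open>\<i> * (A x y - A y x)\<close> real.\<close>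

lemma psd_on_hermitian:
  assumes "finite I" "psd_on I A" "x \<in> I" "y \<in> I"
  shows "A y x = cnj (A x y)"
proof (cases "x = y")
  case True
  then show ?thesis
    using psd_on_diag[OF assms(1-3)]
    by (simp add: complex_eq_iff complex_nonneg_Reals_iff)
next
  case False
  then show ?thesis
    using psd_on_two_point[OF assms False, of 1] psd_on_two_point[OF assms False, of \<i>]
      psd_on_diag[OF assms(1,2,3)] psd_on_diag[OF assms(1,2,4)]
    by (simp add: complex_eq_iff complex_nonneg_Reals_iff)
qed

text \<open>The four phases 1, -1, \<i>, -\<i> bound the real and the imaginary part by the mean of
  two diagonal entries. The crude factor 2 is harmless, since only boundedness is used
  later.\<close>

lemma psd_on_norm_le:
  assumes "finite I" "psd_on I A" "x \<in> I" "y \<in> I"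
    and c: "\<And>z. z \<in> I \<Longrightarrow> Re (A z z) \<le> c"
  shows "norm (A x y) \<le> 2 * c"
proof (cases "x = y")
  case True
  then show ?thesis
    using psd_on_diag[OF assms(1-3)] c[OF assms(3)]
    by (simp add: nonneg_Reals_cmod_eq_Re complex_nonneg_Reals_iff)
next
  case False
  note tp = psd_on_two_point[OF assms(1-4) False]
  have "\<bar>Re (A x y)\<bar> \<le> c" "\<bar>Im (A x y)\<bar> \<le> c"
    using tp[of 1] tp[of "-1"] tp[of \<i>] tp[of "-\<i>"]
      psd_on_hermitian[OF assms(1-4)] c[OF assms(3)] c[OF assms(4)]
    by (auto simp: complex_nonneg_Reals_iff abs_le_iff)
  then show ?thesis
    using cmod_le[of "A x y"] by linarith
qed

text \<open>For each fixed vector the condition is the preimage of a closed half-line under a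
  continuous map.\<close>

lemma closed_psd_on:
  fixes F :: "'a::topological_space \<Rightarrow> 'i \<Rightarrow> 'i \<Rightarrow> complex"
  assumes [continuous_intros]: "\<And>x y. continuous_on UNIV (\<lambda>p. F p x y)"
  shows "closed {p. psd_on I (F p)}"
  unfolding psd_on_def
  by (intro closed_Collect_all closed_vimage[OF closed_nonneg_Reals_complex, unfolded vimage_def]
      continuous_intros)

section \<open>Compactness of the set of simulable POVMs\<close>

text \<open>At each diagonal position the entries of the effects are nonnegative and sum to 1, so
  none exceeds 1; positivity then controls the other entries.\<close>

lemma povm_norm_entry_le:
  assumes "povm P"
  shows "norm (P $ i $ x $ y) \<le> 2"
proof -
  have psd: "psd_on UNIV (\<lambda>x y. P $ i $ x $ y)" for i
    using assms by (simp add: povm_def psd_def)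
  have nonneg: "0 \<le> Re (P $ i $ z $ z)" for i z
    using psd_on_diag[OF _ psd, of z i] by (simp add: complex_nonneg_Reals_iff)
  have "Re (P $ i $ z $ z) \<le> 1" for z
  proof -
    have "Re (P $ i $ z $ z) \<le> (\<Sum>i\<in>UNIV. Re (P $ i $ z $ z))"
      using nonneg by (intro member_le_sum) auto
    also have "\<dots> = Re ((\<Sum>i\<in>UNIV. P $ i) $ z $ z)"
      by simp
    also have "\<dots> = 1"
      using assms by (simp add: povm_def mat_def)
    finally show ?thesis .
  qed
  then show ?thesis
    using psd_on_norm_le[OF _ psd, where c = 1] by simp
qed

lemma norm_vec_le_card:
  fixes v :: "'a::real_normed_vector^'b"
  assumes "\<And>i. norm (v $ i) \<le> c"
  shows "norm v \<le> real CARD('b) * c"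
proof -
  have "norm v \<le> (\<Sum>i\<in>UNIV. norm (v $ i))"
    unfolding norm_vec_def by (rule L2_set_le_sum) simp
  also have "\<dots> \<le> real CARD('b) * c"
    using assms by (rule sum_bounded_above)
  finally show ?thesis .
qed

lemma compact_projective_povm: "compact {P :: complex^'d^'d^'n. projective_povm P}"
proof (rule compact_eq_bounded_closed[THEN iffD2, OF conjI])
  have "norm P \<le> real CARD('n) * (real CARD('d) * (real CARD('d) * 2))"
    if "projective_povm P" for P :: "complex^'d^'d^'n"
    using that by (intro norm_vec_le_card povm_norm_entry_le) (simp add: projective_povm_def)
  then show "bounded {P :: complex^'d^'d^'n. projective_povm P}"
    unfolding bounded_iff by blast
next
  have "continuous_on UNIV (\<lambda>P :: complex^'d^'d^'n. P $ i ** P $ j)" for i j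
    unfolding matrix_matrix_mult_def by (intro continuous_intros)
  moreover have "continuous_on UNIV (\<lambda>P :: complex^'d^'d^'n. if i = j then P $ i else 0)" for i j
    by (cases "i = j") (auto intro: continuous_intros)
  ultimately show "closed {P :: complex^'d^'d^'n. projective_povm P}"
    unfolding projective_povm_def povm_def psd_def
    by (intro closed_Collect_conj closed_Collect_all closed_psd_on closed_Collect_eq
        continuous_intros)
qed

text \<open>In finite dimension the convex hull of a compact set is compact. This is what makes the
  critical visibility an attained maximum.\<close>

lemma compact_simulable: "compact (simulable :: (complex^'d^'d^'n) set)"
  unfolding simulable_def by (intro compact_convex_hull compact_projective_povm)

section \<open>Depolarization and visibility 0\<close>

lemma continuous_on_depolarize:
  "continuous_on S (\<lambda>t. depolarize t X)"
  unfolding depolarize_def by (intro continuous_intros)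

lemma depolarize_one [simp]: "depolarize 1 X = X"
  by (simp add: depolarize_def)

text \<open>At visibility 0 every POVM becomes a mixture of the deterministic projective POVMs
  \<open>P i = (if i = k then mat 1 else 0)\<close>, with weights \<open>Tr (M k) / d\<close>.\<close>

lemma depolarize_povm_0_simulable:
  fixes M :: "complex^'d^'d^'n"
  assumes "povm M"
  shows "depolarize_povm 0 M \<in> simulable"
proof -
  define D :: "'n \<Rightarrow> complex^'d^'d^'n" where "D k = (\<chi> i. if i = k then mat 1 else 0)" for k
  define p where "p k = Re (trace (M $ k)) / CARD('d)" for k
  have diag: "M $ k $ x $ x \<in> \<real>\<^sub>\<ge>\<^sub>0" for k x
    using assms psd_on_diag[of UNIV "\<lambda>x y. M $ k $ x $ y" x] by (simp add: povm_def psd_def)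
  then have tr: "trace (M $ k) \<in> \<real>\<^sub>\<ge>\<^sub>0" for k
    unfolding trace_def by (simp add: complex_nonneg_Reals_iff sum_nonneg)
  \<comment> \<open>The identity is its own Gram matrix.\<close>
  have "psd_on UNIV (\<lambda>x y. (mat 1 :: complex^'d^'d) $ x $ y)"
    using psd_on_gram[where I = UNIV and Z = UNIV and B = "\<lambda>x y. (mat 1 :: complex^'d^'d) $ x $ y"]
    by (simp add: mat_def if_distrib[of cnj] if_distrib[of "\<lambda>x. x * _"] cong: if_cong)
  then have "projective_povm (D k)" for k
    by (auto simp: projective_povm_def povm_def psd_def D_def psd_on_def)
  moreover have "(\<Sum>k\<in>UNIV. p k) = 1"
  proof -
    have "(\<Sum>k\<in>UNIV. trace (M $ k)) = trace (\<Sum>k\<in>UNIV. M $ k)"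
      unfolding trace_def by (subst sum.swap) simp
    also have "\<dots> = of_nat CARD('d)"
      using assms by (simp add: povm_def trace_I)
    finally have "Re (\<Sum>k\<in>UNIV. trace (M $ k)) = CARD('d)"
      by simp
    then show ?thesis
      by (simp add: p_def flip: sum_divide_distrib)
  qed
  moreover have "0 \<le> p k" for k
    using tr[of k] by (simp add: p_def complex_nonneg_Reals_iff)
  ultimately have "(\<Sum>k\<in>UNIV. p k *\<^sub>R D k) \<in> simulable"
    unfolding simulable_def
    by (intro convex_sum[OF _ convex_convex_hull]) (auto intro: hull_inc)
  also have "(\<Sum>k\<in>UNIV. p k *\<^sub>R D k) = depolarize_povm 0 M"
  proof -
    have "(\<Sum>k\<in>UNIV. p k *\<^sub>R D k) $ i $ x $ y = depolarize_povm 0 M $ i $ x $ y" for i x y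
    proof -
      \<comment> \<open>The trace is real, so \<open>Re\<close> in the weight \<open>p\<close> loses
        nothing.\<close>
      have "trace (M $ i) = of_real (Re (trace (M $ i)))"
        using tr[of i] by (simp add: complex_eq_iff complex_nonneg_Reals_iff)
      then have "trace (M $ i) / of_nat CARD('d) = of_real (p i)"
        unfolding p_def by (metis of_real_divide of_real_of_nat_eq)
      moreover have "(p k *\<^sub>R D k) $ i $ x $ y
          = (if k = i then of_real (p i) * mat 1 $ x $ y else 0)" for k
        unfolding D_def by (simp add: scaleR_conv_of_real[where 'a = complex])
      ultimately show ?thesis
        by (simp add: depolarize_povm_def depolarize_def mat_def del: vector_scaleR_component)
    qed
    then show ?thesis
      by (simp add: vec_eq_iff)
  qed
  finally show ?thesis .
qed

section \<open>The hierarchy\<close>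

lemma finite_tuples [simp]: "finite S \<Longrightarrow> finite (tuples S :: (nat \<Rightarrow> 'a::finite) set)"
  by (simp add: tuples_def finite_PiE)

text \<open>The visibility enters the constraints only through the target effects. Absorbing it into
  the POVM allows convexity arguments in the target alone.\<close>

lemma feasible_depolarize:
  "feasible m M t R \<longleftrightarrow> feasible m (depolarize_povm t M) 1 R"
  unfolding feasible_def depolarize_povm_def depolarize_one vec_lambda_beta ..

lemma feasibleD:
  assumes "feasible m M t R"
  shows "i \<in> tuples {1..m} \<Longrightarrow> psd_on (tuples {1..m}) (R i)"
    and "\<lbrakk>j \<in> {1..m}; x \<in> tuples {1..m}; y \<in> tuples {1..m}\<rbrakk> \<Longrightarrow>
      (\<Sum>i | i \<in> tuples {1..m} \<and> i j = k. R i x y) =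
      tensor {1..m} (\<lambda>a. if a = j then depolarize t (M $ k) else mat 1) x y"
    and "\<lbrakk>a \<in> {1..m}; b \<in> {1..m}; i \<in> tuples {1..m}; a < b; i a \<noteq> i b;
      x \<in> tuples ({1..m} - {a}); y \<in> tuples ({1..m} - {a})\<rbrakk> \<Longrightarrow>
      partial_trace a (tmat_mult {1..m} (swap_mat a b) (R i)) x y = 0"
  using assms[unfolded feasible_def, THEN conjunct1]
    assms[unfolded feasible_def, THEN conjunct2, THEN conjunct1]
    assms[unfolded feasible_def, THEN conjunct2, THEN conjunct2]
  by meson+

text \<open>The swap is a permutation matrix, so each of its rows selects a single term: the traced
  index \<open>k\<close> moves to factor \<open>b\<close> and the entry \<open>x b\<close> moves to
  factor \<open>a\<close>.\<close>

lemma partial_trace_swap: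
  assumes "finite S" "a \<in> S" "b \<in> S" "a \<noteq> b" "x \<in> tuples (S - {a})"
  shows "partial_trace a (tmat_mult S (swap_mat a b) A) x y
    = (\<Sum>k\<in>UNIV. A (x(a := x b, b := k)) (y(a := k)))"
proof -
  have "(\<Sum>z\<in>tuples S. swap_mat a b (x(a := k)) z * A z (y(a := k)))
      = A (x(a := x b, b := k)) (y(a := k))" for k
  proof -
    have "x(a := k) = z(a := z b, b := z a) \<longleftrightarrow> z = x(a := x b, b := k)" for z
      using assms(4) by (auto simp: fun_eq_iff)
    moreover have "x(a := x b, b := k) \<in> tuples S"
      using assms by (auto simp: tuples_def PiE_iff extensional_def)
    ultimately show ?thesis
      using assms(1) by (simp add: swap_mat_def if_distrib[of "\<lambda>x. x * _"] cong: if_cong)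
  qed
  then show ?thesis
    by (simp add: partial_trace_def tmat_mult_def)
qed

section \<open>Feasibility of simulable POVMs at every level\<close>

lemma feasible_projective:
  fixes P :: "complex^'d^'d^'n"
  assumes "projective_povm P"
  shows "feasible m P 1 (\<lambda>i. tensor {1..m} (\<lambda>a. P $ i a))"
proof -
  have psd: "psd_on UNIV (\<lambda>x y. P $ i $ x $ y)" for i
    using assms by (simp add: projective_povm_def povm_def psd_def)
  have sum1: "(\<Sum>i\<in>UNIV. P $ i) = mat 1"
    using assms by (simp add: projective_povm_def povm_def)
  have orth: "P $ i ** P $ j = (if i = j then P $ i else 0)" for i j
    using assms by (simp add: projective_povm_def)
  have herm: "cnj (P $ i $ z $ x) = P $ i $ x $ z" for i x z
    using psd_on_hermitian[OF _ psd, of z x i] by simp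
  have prod: "(\<Sum>z\<in>UNIV. P $ i $ x $ z * P $ j $ z $ y) = (if i = j then P $ i $ x $ y else 0)"
    for i j x y
    using arg_cong[OF orth[of i j], of "\<lambda>A. A $ x $ y"]
    by (simp add: matrix_matrix_mult_def split: if_splits)
  show ?thesis
    unfolding feasible_def depolarize_one
  proof (intro conjI ballI allI impI)
    fix i :: "nat \<Rightarrow> 'n"
    let ?T = "tensor {1..m} (\<lambda>a. P $ i a)"
    \<comment> \<open>Each factor is hermitian and idempotent, hence so is the product operator,
      which is therefore its own Gram matrix.\<close>
    have "psd_on (tuples {1..m}) (\<lambda>x y. \<Sum>z\<in>tuples {1..m}. cnj (?T z x) * ?T z y)"
      by (rule psd_on_gram)
    also have "(\<lambda>x y. \<Sum>z\<in>tuples {1..m}. cnj (?T z x) * ?T z y) = ?T"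
    proof (intro ext)
      fix x y
      have "(\<Sum>z\<in>tuples {1..m}. cnj (?T z x) * ?T z y)
          = (\<Sum>z\<in>tuples {1..m}. \<Prod>a\<in>{1..m}. P $ i a $ x a $ z a * P $ i a $ z a $ y a)"
        by (simp add: tensor_def herm prod.distrib)
      also have "\<dots> = (\<Prod>a\<in>{1..m}. \<Sum>z\<in>UNIV. P $ i a $ x a $ z * P $ i a $ z $ y a)"
        unfolding tuples_def by (rule prod_sum_PiE[symmetric]) auto
      also have "\<dots> = ?T x y"
        by (simp add: prod tensor_def)
      finally show "(\<Sum>z\<in>tuples {1..m}. cnj (?T z x) * ?T z y) = ?T x y" .
    qed
    finally show "psd_on (tuples {1..m}) ?T" .
  next
    fix j :: nat and k :: 'n and x y :: "nat \<Rightarrow> 'd"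
    \<comment> \<open>Fixing outcome \<open>j\<close> leaves a product set of outcomes, so the sum
      of products factorises; every factor other than \<open>j\<close> sums to the identity.\<close>
    let ?B = "\<lambda>a. if a = j then {k} else UNIV"
    assume "j \<in> {1..m}"
    then have eq: "{i \<in> tuples {1..m}. i j = k} = PiE {1..m} ?B"
      unfolding tuples_def set_eq_iff PiE_iff mem_Collect_eq by (auto split: if_splits)
    have "(\<Sum>i | i \<in> tuples {1..m} \<and> i j = k. tensor {1..m} (\<lambda>a. P $ i a) x y)
        = (\<Prod>a\<in>{1..m}. \<Sum>l\<in>?B a. P $ l $ x a $ y a)"
      unfolding tensor_def eq by (subst prod_sum_PiE) auto
    also have "\<dots> = tensor {1..m} (\<lambda>a. if a = j then P $ k else mat 1) x y"
      unfolding tensor_def sum1[symmetric] by (rule prod.cong) auto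
    finally show "(\<Sum>i | i \<in> tuples {1..m} \<and> i j = k. tensor {1..m} (\<lambda>a. P $ i a) x y)
        = tensor {1..m} (\<lambda>a. if a = j then P $ k else mat 1) x y" .
  next
    fix a b and i :: "nat \<Rightarrow> 'n" and x y :: "nat \<Rightarrow> 'd"
    assume ab: "a \<in> {1..m}" "b \<in> {1..m}" "a < b" "i a \<noteq> i b"
      and x: "x \<in> tuples ({1..m} - {a})"
    \<comment> \<open>The factors other than \<open>a\<close> and \<open>b\<close> do not depend on
      \<open>k\<close>. What remains is the entry at \<open>x b\<close>, \<open>y b\<close> of the
      matrix product of \<open>P $ i a\<close> and \<open>P $ i b\<close>, which vanishes by
      orthogonality.\<close>
    let ?C = "\<Prod>c\<in>{1..m} - {a} - {b}. P $ i c $ x c $ y c"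
    have "prod f {1..m} = f a * (f b * prod f ({1..m} - {a} - {b}))" for f :: "nat \<Rightarrow> complex"
      using ab by (simp add: prod.remove[of _ a] prod.remove[of _ b])
    moreover have "(\<Prod>c\<in>{1..m} - {a} - {b}. P $ i c $ (x(a := x b, b := k)) c $ (y(a := k)) c) = ?C" for k
      by (rule prod.cong) auto
    ultimately have "tensor {1..m} (\<lambda>c. P $ i c) (x(a := x b, b := k)) (y(a := k))
        = P $ i a $ x b $ k * P $ i b $ k $ y b * ?C" for k
      using ab by (simp add: tensor_def)
    then have "(\<Sum>k\<in>UNIV. tensor {1..m} (\<lambda>c. P $ i c) (x(a := x b, b := k)) (y(a := k)))
        = (\<Sum>k\<in>UNIV. P $ i a $ x b $ k * P $ i b $ k $ y b) * ?C"
      by (simp add: sum_distrib_right)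
    also have "\<dots> = 0"
      using ab by (simp add: prod)
    finally show "partial_trace a (tmat_mult {1..m} (swap_mat a b)
        (tensor {1..m} (\<lambda>a. P $ i a))) x y = 0"
      using ab x by (simp add: partial_trace_swap)
  qed
qed

text \<open>Splitting off factor \<open>j\<close> exhibits the marginal as linear in
  \<open>X\<close>.\<close>

lemma tensor_single:
  assumes "finite S" "j \<in> S"
  shows "tensor S (\<lambda>a. if a = j then X else mat 1) x y
    = X $ x j $ y j * (\<Prod>a\<in>S - {j}. mat 1 $ x a $ y a)"
  unfolding tensor_def using assms by (subst prod.remove[of _ j]) auto

text \<open>The POVMs admitting a feasible \<open>R\<close> form a convex set containing the
  projective ones, hence it contains their convex hull.\<close>

lemma feasible_simulable:
  fixes N :: "complex^'d^'d^'n"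
  assumes "N \<in> simulable"
  shows "\<exists>R. feasible m N 1 R"
proof -
  have "convex {N :: complex^'d^'d^'n. \<exists>R. feasible m N 1 R}"
  proof (rule convexI, clarify)
    fix N1 N2 :: "complex^'d^'d^'n" and R1 R2 and u v :: real
    assume R: "feasible m N1 1 R1" "feasible m N2 1 R2" and uv: "0 \<le> u" "0 \<le> v"
    let ?R = "\<lambda>i x y. u *\<^sub>R R1 i x y + v *\<^sub>R R2 i x y"
    have "feasible m (u *\<^sub>R N1 + v *\<^sub>R N2) 1 ?R"
      unfolding feasible_def depolarize_one
    proof (intro conjI ballI allI impI)
      fix i :: "nat \<Rightarrow> 'n"
      assume "i \<in> tuples {1..m}"
      then show "psd_on (tuples {1..m}) (?R i)"
        using R[THEN feasibleD(1)] uv by (intro psd_on_add psd_on_scaleR)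
    next
      fix j :: nat and k :: 'n and x y :: "nat \<Rightarrow> 'd"
      assume "j \<in> {1..m}" "x \<in> tuples {1..m}" "y \<in> tuples {1..m}"
      then show "(\<Sum>i | i \<in> tuples {1..m} \<and> i j = k. ?R i x y)
          = tensor {1..m} (\<lambda>a. if a = j then (u *\<^sub>R N1 + v *\<^sub>R N2) $ k else mat 1) x y"
        using R[THEN feasibleD(2)]
        by (simp add: tensor_single sum.distrib algebra_simps flip: scaleR_sum_right)
    next
      fix a b and i :: "nat \<Rightarrow> 'n" and x y :: "nat \<Rightarrow> 'd"
      assume ab: "a \<in> {1..m}" "b \<in> {1..m}" "i \<in> tuples {1..m}" "a < b" "i a \<noteq> i b"
        and xy: "x \<in> tuples ({1..m} - {a})" "y \<in> tuples ({1..m} - {a})"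
      let ?pt = "\<lambda>A. partial_trace a (tmat_mult {1..m} (swap_mat a b) A) x y"
      have "?pt (?R i) = u *\<^sub>R ?pt (R1 i) + v *\<^sub>R ?pt (R2 i)"
        by (simp add: partial_trace_def tmat_mult_def sum.distrib scaleR_sum_right ring_distribs)
      then show "?pt (?R i) = 0"
        using feasibleD(3)[OF R(1) ab xy] feasibleD(3)[OF R(2) ab xy] by simp
    qed
    then show "\<exists>R. feasible m (u *\<^sub>R N1 + v *\<^sub>R N2) 1 R"
      by (rule exI[of _ ?R])
  qed
  then have "simulable \<subseteq> {N :: complex^'d^'d^'n. \<exists>R. feasible m N 1 R}"
    unfolding simulable_def by (intro hull_minimal) (auto intro: feasible_projective)
  then show ?thesis
    using assms by blast
qed

section \<open>Passage from level m + 1 to level m\<close>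

text \<open>Compressing the last factor to a fixed basis vector \<open>q\<close> preserves all constraints;
  it plays the role of the normalised partial trace over that factor.\<close>

lemma feasible_Suc:
  fixes M :: "complex^'d^'d^'n"
  assumes "feasible (Suc m) M t R"
  shows "\<exists>R'. feasible m M t R'"
proof -
  \<comment> \<open>Any basis vector would do; \<open>undefined\<close> merely names one.\<close>
  define q :: 'd where "q = undefined"
  define e :: "(nat \<Rightarrow> 'd) \<Rightarrow> nat \<Rightarrow> 'd" where "e x = x(Suc m := q)" for x
  define R' where "R' i x y = (\<Sum>l\<in>UNIV. R (i(Suc m := l)) (e x) (e y))" for i x y
  have upd: "z(Suc m := l) \<in> tuples {1..Suc m}" if "z \<in> tuples {1..m}" for z :: "nat \<Rightarrow> 'a" and l
    using that by (auto simp: tuples_def PiE_iff extensional_def)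
  have upd': "e x \<in> tuples ({1..Suc m} - {a})" if "x \<in> tuples ({1..m} - {a})" "a \<in> {1..m}" for x a
    using that by (auto simp: e_def tuples_def PiE_iff extensional_def)
  have "feasible m M t R'"
    unfolding feasible_def
  proof (intro conjI ballI allI impI)
    fix i :: "nat \<Rightarrow> 'n"
    assume i: "i \<in> tuples {1..m}"
    \<comment> \<open>Tuples over \<open>{1..m}\<close> all take the value \<open>undefined\<close>
      at \<open>Suc m\<close>, so overwriting that position loses no information.\<close>
    have inj: "inj_on e (tuples {1..m})"
    proof (rule inj_onI)
      fix x y
      assume xy: "x \<in> tuples {1..m}" "y \<in> tuples {1..m}" and "e x = e y"
      then have "x a = y a" if "a \<noteq> Suc m" for a
        using that by (metis e_def fun_upd_other)
      moreover have "x (Suc m) = y (Suc m)"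
        using xy by (simp add: tuples_def PiE_iff extensional_def)
      ultimately show "x = y"
        by (metis ext)
    qed
    have sub: "e ` tuples {1..m} \<subseteq> tuples {1..Suc m}"
      using upd by (auto simp: e_def)
    have "psd_on (tuples {1..Suc m}) (R (i(Suc m := l)))" for l
      using feasibleD(1)[OF assms upd[OF i]] .
    then have "psd_on (tuples {1..m}) (\<lambda>x y. R (i(Suc m := l)) (e x) (e y))" for l
      by (rule psd_on_reindex[OF finite_tuples[OF finite_atLeastAtMost] _ inj sub])
    then show "psd_on (tuples {1..m}) (R' i)"
      unfolding R'_def by (rule psd_on_sum)
  next
    fix j :: nat and k :: 'n and x y :: "nat \<Rightarrow> 'd"
    assume j: "j \<in> {1..m}" and xy: "x \<in> tuples {1..m}" "y \<in> tuples {1..m}"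
    have "(\<Sum>i | i \<in> tuples {1..m} \<and> i j = k. R' i x y)
        = (\<Sum>(i, l)\<in>{i \<in> tuples {1..m}. i j = k} \<times> UNIV. R (i(Suc m := l)) (e x) (e y))"
      by (simp add: R'_def sum.cartesian_product)
    \<comment> \<open>A tuple of length \<open>Suc m\<close> is a shorter tuple with a last outcome;
      the inverse resets position \<open>Suc m\<close> to \<open>undefined\<close> to stay
      extensional.\<close>
    also have "\<dots> = (\<Sum>i | i \<in> tuples {1..Suc m} \<and> i j = k. R i (e x) (e y))"
      using j
      by (intro sum.reindex_bij_witness[where j = "\<lambda>(i, l). i(Suc m := l)"
            and i = "\<lambda>i. (i(Suc m := undefined), i (Suc m))"])
        (auto simp: tuples_def PiE_iff extensional_def)
    also have "\<dots> = tensor {1..Suc m} (\<lambda>a. if a = j then depolarize t (M $ k) else mat 1) (e x) (e y)"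
      using feasibleD(2)[OF assms, of j] j upd[OF xy(1)] upd[OF xy(2)]
      by (simp add: e_def del: One_nat_def)
    \<comment> \<open>Since \<open>j\<close> is at most \<open>m\<close>, the last factor is the
      identity, and its diagonal entry at \<open>q\<close> is 1.\<close>
    also have "\<dots> = tensor {1..m} (\<lambda>a. if a = j then depolarize t (M $ k) else mat 1) x y"
      using j by (simp add: tensor_def e_def atLeastAtMostSuc_conv mat_def)
    finally show "(\<Sum>i | i \<in> tuples {1..m} \<and> i j = k. R' i x y)
        = tensor {1..m} (\<lambda>a. if a = j then depolarize t (M $ k) else mat 1) x y" .
  next
    fix a b and i :: "nat \<Rightarrow> 'n" and x y :: "nat \<Rightarrow> 'd"
    assume ab: "a \<in> {1..m}" "b \<in> {1..m}" "a < b" "i a \<noteq> i b" and i: "i \<in> tuples {1..m}"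
      and xy: "x \<in> tuples ({1..m} - {a})" "y \<in> tuples ({1..m} - {a})"
    \<comment> \<open>Appending \<open>l\<close> does not affect outcomes \<open>a\<close> and
      \<open>b\<close>, so the constraint vanishes for each \<open>l\<close> separately. The updates
      at \<open>a\<close> and \<open>b\<close> commute with the one at \<open>Suc m\<close>.\<close>
    have "(\<Sum>k\<in>UNIV. R (i(Suc m := l)) (e (x(a := x b, b := k))) (e (y(a := k)))) = 0" for l
    proof -
      let ?S = "{1..Suc m}"
      have "partial_trace a (tmat_mult ?S (swap_mat a b) (R (i(Suc m := l)))) (e x) (e y) = 0"
        using feasibleD(3)[OF assms, of a b] ab upd[OF i] upd'[OF xy(1)] upd'[OF xy(2)]
        by (simp del: One_nat_def)
      then have "(\<Sum>k\<in>UNIV. R (i(Suc m := l)) ((e x)(a := e x b, b := k)) ((e y)(a := k))) = 0"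
        using ab upd'[OF xy(1)] by (subst (asm) partial_trace_swap) auto
      then show ?thesis
        using ab by (simp add: e_def fun_upd_twist)
    qed
    then show "partial_trace a (tmat_mult {1..m} (swap_mat a b) (R' i)) x y = 0"
      unfolding R'_def using ab xy by (simp add: partial_trace_swap) (subst sum.swap, simp)
  qed
  then show ?thesis
    by (rule exI[of _ R'])
qed

section \<open>Attainment of the hierarchy maxima\<close>

text \<open>Cutting off the meaningless entries of \<open>R\<close> makes the feasible points uniformly bounded.\<close>

lemma feasible_bounded:
  fixes M :: "complex^'d^'d^'n"
  assumes "0 < m"
  obtains C where "\<And>t R. 0 \<le> t \<Longrightarrow> t \<le> 1 \<Longrightarrow> feasible m M t R \<Longrightarrow>
    \<exists>R'. feasible m M t R' \<and> (\<forall>i x y. norm (R' i x y) \<le> C)"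
proof -
  let ?I = "tuples {1..m} :: (nat \<Rightarrow> 'd) set" and ?N = "tuples {1..m} :: (nat \<Rightarrow> 'n) set"
  \<comment> \<open>Depolarizing is a convex combination of two fixed matrices, which bounds it
    uniformly in \<open>t\<close>; summing over the effects makes the bound uniform in
    \<open>k\<close>.\<close>
  obtain C where C: "0 \<le> C" "\<And>k t z. 0 \<le> t \<Longrightarrow> t \<le> 1 \<Longrightarrow> norm (depolarize t (M $ k) $ z $ z) \<le> C"
  proof
    let ?B = "\<lambda>k. norm (M $ k) + norm (mat (trace (M $ k) / of_nat CARD('d)) :: complex^'d^'d)"
    show "0 \<le> (\<Sum>k\<in>UNIV. ?B k)"
      by (intro sum_nonneg add_nonneg_nonneg) auto
    fix k t z
    assume t: "0 \<le> t" "t \<le> (1::real)"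
    have "norm (depolarize t (M $ k) $ z $ z) \<le> norm (depolarize t (M $ k))"
      by (meson Finite_Cartesian_Product.norm_nth_le order_trans)
    also have "\<dots> \<le> t * norm (M $ k) + (1 - t) * norm (mat (trace (M $ k) / of_nat CARD('d)) :: complex^'d^'d)"
      unfolding depolarize_def using t by (intro norm_triangle_le) simp
    also have "\<dots> \<le> ?B k"
      using t by (intro add_mono mult_left_le_one_le) auto
    also have "\<dots> \<le> (\<Sum>k\<in>UNIV. ?B k)"
      by (intro member_le_sum) auto
    finally show "norm (depolarize t (M $ k) $ z $ z) \<le> (\<Sum>k\<in>UNIV. ?B k)" .
  qed
  show ?thesis
  proof (rule that, intro exI conjI allI)
    fix t R
    assume t: "0 \<le> t" "t \<le> 1" and R: "feasible m M t R"
    let ?R = "\<lambda>i x y. if i \<in> ?N \<and> x \<in> ?I \<and> y \<in> ?I then R i x y else 0"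
    \<comment> \<open>The swap constraint reads \<open>R\<close> only at indices of these two forms,
      so the cut-off does not change it.\<close>
    have upd: "x(a := k) \<in> ?I" if "x \<in> tuples ({1..m} - {a})" "a \<in> {1..m}"
      for x :: "nat \<Rightarrow> 'd" and a k
      using that by (auto simp: tuples_def PiE_iff extensional_def)
    have upd': "x(a := x b, b := k) \<in> ?I"
      if "x \<in> tuples ({1..m} - {a})" "a \<in> {1..m}" "b \<in> {1..m}"
      for x :: "nat \<Rightarrow> 'd" and a b k
      using that by (auto simp: tuples_def PiE_iff extensional_def)
    show "feasible m M t ?R"
      unfolding feasible_def
    proof (intro conjI ballI allI impI)
      fix i
      assume "i \<in> ?N"
      then show "psd_on ?I (?R i)"
        using feasibleD(1)[OF R] by (simp add: psd_on_def cong: sum.cong)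
    next
      fix j k x y
      assume "j \<in> {1..m}" "x \<in> ?I" "y \<in> ?I"
      then show "(\<Sum>i | i \<in> ?N \<and> i j = k. ?R i x y)
          = tensor {1..m} (\<lambda>a. if a = j then depolarize t (M $ k) else mat 1) x y"
        using feasibleD(2)[OF R] by simp
    next
      fix a b i and x y :: "nat \<Rightarrow> 'd"
      assume "a \<in> {1..m}" "b \<in> {1..m}" "i \<in> ?N" "a < b" "i a \<noteq> i b"
        "x \<in> tuples ({1..m} - {a})" "y \<in> tuples ({1..m} - {a})"
      then show "partial_trace a (tmat_mult {1..m} (swap_mat a b) (?R i)) x y = 0"
        using feasibleD(3)[OF R, of a b i x y]
        by (simp add: partial_trace_swap upd upd' del: One_nat_def)
    qed
    fix i x y
    show "norm (?R i x y) \<le> 2 * C"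
    proof (cases "i \<in> ?N \<and> x \<in> ?I \<and> y \<in> ?I")
      case True
      have psd: "psd_on ?I (R i)" if "i \<in> ?N" for i
        using feasibleD(1)[OF R that] .
      have "Re (R i z z) \<le> C" if z: "z \<in> ?I" for z
      proof -
        \<comment> \<open>Diagonal entries are nonnegative, so each is at most its sum over all
          outcomes sharing the first one, and that sum is a prescribed marginal. Factor 1 exists
          because \<open>m\<close> is positive.\<close>
        let ?L = "{i' \<in> ?N. i' 1 = i 1}"
        have "Re (R i z z) \<le> (\<Sum>i'\<in>?L. Re (R i' z z))"
          using True psd_on_diag[OF _ psd z]
          by (intro member_le_sum) (auto simp: complex_nonneg_Reals_iff)
        also have "\<dots> = Re (\<Sum>i'\<in>?L. R i' z z)"
          by simp
        also have "\<dots> = Re (tensor {1..m} (\<lambda>a. if a = 1 then depolarize t (M $ i 1) else mat 1) z z)"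
          using feasibleD(2)[OF R, of 1 z z] z assms by (simp del: One_nat_def)
        also have "\<dots> = Re (depolarize t (M $ i 1) $ z 1 $ z 1)"
          using assms by (subst tensor_single) (auto simp: mat_def)
        also have "\<dots> \<le> C"
          using C(2)[OF t] complex_Re_le_cmod order_trans by blast
        finally show ?thesis .
      qed
      then show ?thesis
        using True psd_on_norm_le[OF _ psd, of i x y C] by simp
    next
      case False
      then show ?thesis
        using C(1) by auto
    qed
  qed
qed

text \<open>The set is the projection to \<open>t\<close> of a compact set of pairs (t, R). Each
  feasible \<open>t\<close> has a bounded \<open>R\<close>, so restricting \<open>R\<close> to the
  cube \<open>B\<close> loses no \<open>t\<close>.\<close>

lemma compact_feasible:
  fixes M :: "complex^'d^'d^'n"
  assumes "0 < m"
  shows "compact {t. 0 \<le> t \<and> t \<le> 1 \<and> (\<exists>R. feasible m M t R)}"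
proof -
  \<comment> \<open>Uncurrying \<open>R\<close> makes it a point of a single product space.\<close>
  let ?R = "\<lambda>(r :: (nat \<Rightarrow> 'n) \<times> (nat \<Rightarrow> 'd) \<times> (nat \<Rightarrow> 'd) \<Rightarrow> complex) i x y. r (i, x, y)"
  obtain C where C: "\<And>t R. 0 \<le> t \<Longrightarrow> t \<le> 1 \<Longrightarrow> feasible m M t R \<Longrightarrow>
    \<exists>R'. feasible m M t R' \<and> (\<forall>i x y. norm (R' i x y) \<le> C)"
    using feasible_bounded[OF assms] by blast
  define B :: "((nat \<Rightarrow> 'n) \<times> (nat \<Rightarrow> 'd) \<times> (nat \<Rightarrow> 'd) \<Rightarrow> complex) set"
    where "B = PiE UNIV (\<lambda>_. cball 0 C)"
  define K where "K = ({0..1} \<times> B) \<inter> {p. feasible m M (fst p) (?R (snd p))}"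
  \<comment> \<open>The index set of triples may be infinite, so this is Tychonoff's theorem rather
    than Heine-Borel.\<close>
  have "compact B"
    unfolding B_def using compactin_PiE[of "\<lambda>_. euclidean" "UNIV :: ((nat \<Rightarrow> 'n) \<times> (nat \<Rightarrow> 'd) \<times> (nat \<Rightarrow> 'd)) set"
        "\<lambda>_. cball (0 :: complex) C"]
    by (simp add: euclidean_product_topology)
  moreover have "closed {p. feasible m M (fst p) (?R (snd p))}"
  proof -
    have [continuous_intros]:
      "continuous_on UNIV (\<lambda>p. ?R (snd p) i x y)"
      for i x y
      by (rule continuous_on_compose2[OF continuous_on_product_coordinates])
        (auto intro: continuous_intros)
    \<comment> \<open>Only factor \<open>j\<close> depends on \<open>t\<close>, and it does so
      affinely.\<close>
    have [continuous_intros]: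
      "continuous_on UNIV (\<lambda>p :: real \<times> ((nat \<Rightarrow> 'n) \<times> (nat \<Rightarrow> 'd) \<times> (nat \<Rightarrow> 'd) \<Rightarrow> complex).
        (if a = j then depolarize (fst p) (M $ k) else mat 1) $ x $ y)"
      for a j :: nat and k x y
      by (cases "a = j") (auto simp: depolarize_def intro!: continuous_intros)
    show ?thesis
      unfolding feasible_def Ball_def tensor_def partial_trace_def tmat_mult_def
      by (intro closed_Collect_conj closed_Collect_all closed_Collect_imp open_Collect_const
          closed_psd_on closed_Collect_eq continuous_intros)
  qed
  ultimately have "compact K"
    unfolding K_def by (intro compact_Int_closed compact_Times) auto
  then have "compact (fst ` K)"
    by (intro compact_continuous_image continuous_intros)
  also have "fst ` K = {t. 0 \<le> t \<and> t \<le> 1 \<and> (\<exists>R. feasible m M t R)}"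
  proof (intro equalityI subsetI)
    fix t
    assume "t \<in> {t. 0 \<le> t \<and> t \<le> 1 \<and> (\<exists>R. feasible m M t R)}"
    then obtain R where "0 \<le> t" "t \<le> 1" "feasible m M t R" "\<forall>i x y. norm (R i x y) \<le> C"
      using C by blast
    then have "(t, \<lambda>(i, x, y). R i x y) \<in> K"
      by (auto simp: K_def B_def)
    then show "t \<in> fst ` K"
      by force
  qed (auto simp: K_def)
  finally show ?thesis .
qed

section \<open>Comparison of the optimal values\<close>

text \<open>A nonempty compact set of reals contains its supremum, which gives
  \<open>Greatest\<close> its meaning.\<close>

lemma Greatest_compact:
  fixes P :: "real \<Rightarrow> bool"
  assumes "compact {t. P t}" "P s"
  shows "P (Greatest P)" "P t \<Longrightarrow> t \<le> Greatest P"
proof -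
  obtain g where "P g" "\<And>t. P t \<Longrightarrow> t \<le> g"
    using compact_attains_sup[OF assms(1)] assms(2) by blast
  then show "P (Greatest P)" "P t \<Longrightarrow> t \<le> Greatest P"
    using Greatest_equality[of P g] by auto
qed

theorem theorem1:
  fixes M :: "complex^'d^'d^'n"
  assumes "povm M"
  shows "\<forall>m\<ge>2. hierarchy_value m M \<ge> hierarchy_value (Suc m) M \<and>
                hierarchy_value m M \<ge> critical_visibility M"
proof (intro allI impI)
  fix m :: nat
  assume m: "2 \<le> m"
  let ?S = "\<lambda>t. 0 \<le> t \<and> t \<le> 1 \<and> depolarize_povm t M \<in> simulable"
  let ?F = "\<lambda>m t. 0 \<le> t \<and> t \<le> 1 \<and> (\<exists>R. feasible m M t R)"
  have SF: "?F m t" if "?S t" for t m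
    using that feasible_simulable feasible_depolarize by blast
  \<comment> \<open>Visibility 0 witnesses that the admissible set is nonempty, also at every level
    through \<open>SF\<close>.\<close>
  have S0: "?S 0"
    using depolarize_povm_0_simulable[OF assms] by simp
  have "closed ((\<lambda>t. depolarize_povm t M) -` simulable)"
    unfolding depolarize_povm_def
    by (intro closed_vimage compact_imp_closed compact_simulable continuous_intros
        continuous_on_depolarize)
  then have "compact ({0..1} \<inter> (\<lambda>t. depolarize_povm t M) -` simulable)"
    by (intro compact_Int_closed) auto
  also have "{0..1} \<inter> (\<lambda>t. depolarize_povm t M) -` simulable = {t. ?S t}"
    by auto
  finally have S: "?S (critical_visibility M)"
    unfolding critical_visibility_def using S0 by (rule Greatest_compact)
  have F: "?F k (hierarchy_value k M)" "\<And>t. ?F k t \<Longrightarrow> t \<le> hierarchy_value k M" if "2 \<le> k" for k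
    using Greatest_compact[OF compact_feasible[of k M] SF[OF S0, of k]] that
    unfolding hierarchy_value_def by auto
  \<comment> \<open>The optimum of the next level is itself feasible at level \<open>m\<close>,
    hence bounded by the optimum there.\<close>
  have "?F m (hierarchy_value (Suc m) M)"
    using F(1)[of "Suc m"] m feasible_Suc by fastforce
  then show "hierarchy_value (Suc m) M \<le> hierarchy_value m M \<and>
      critical_visibility M \<le> hierarchy_value m M"
    using F(2)[OF m] SF[OF S] by blast
qed

end
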